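(* Let $m\geqslant 3$, $n\geqslant 3$ be odd integers, $m=2m_0+1$, $n=2n_0+1$, $m_0^{+}=m_0+1$, $n_0^{+}=n_0+1$. Let $X$ be a bicentrally balanced $C_4$-face-magic projective labeling on $\mathcal{P}_{m,n}$. Then there is a unique bicentrally balanced $C_4$-face-magic projective labeling $Z=\{z_{i,j}\}$ on $\mathcal{P}_{m,n}$ that is projective labeling equivalent to $X$ such that: $z_{i,n_0^{+}}<z_{i+2,n_0^{+}}$ for all $1\leqslant i\leqslant m-2$ with $i+n_0^{+}$ even; $z_{i,n_0^{+}}>z_{i+2,n_0^{+}}$ for all $1\leqslant i\leqslant m-2$ with $i+n_0^{+}$ odd; $z_{m_0^{+},j}<z_{m_0^{+},j+2}$ for all $1\leqslant j\leqslant n-2$ with $m_0^{+}+j$ even; and $z_{m_0^{+},j}>z_{m_0^{+},j+2}$ for all $1\leqslant j\leqslant n-2$ with $m_0^{+}+j$ odd.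
   Context: For integers $m,n\geqslant 2$, the projective grid graph $\mathcal{P}_{m,n}$ has vertex set $\{(i,j):1\leqslant i\leqslant m,\ 1\leqslant j\leqslant n\}$ and edges $(i,j)$–$(i,j+1)$ ($j\leqslant n-1$), $(i,n)$–$(m+1-i,1)$, $(i,j)$–$(i+1,j)$ ($i\leqslant m-1$), $(m,j)$–$(1,n+1-j)$, embedded naturally in the projective plane. Its 4-cycle faces are $\{(i,j),(i+1,j),(i,j+1),(i+1,j+1)\}$ ($1\leqslant i\leqslant m-1$, $1\leqslant j\leqslant n-1$), $\{(i,n),(i+1,n),(m+1-i,1),(m-i,1)\}$ ($1\leqslant i\leqslant m-1$), and $\{(m,j),(m,j+1),(1,n+1-j),(1,n-j)\}$ ($1\leqslant j\leqslant n-1$); the other two faces are digons. A $C_4$-face-magic projective labeling is a bijection $(i,j)\mapsto x_{i,j}$ onto $\{1,\ldots,mn\}$ such that every 4-cycle face has the same label sum (the $C_4$-face-magic value). For odd $m,n$ let $S(i,j)=\tfrac12 mn+\tfrac32$ if $i+j$ is even and $\tfrac32 mn+\tfrac32$ if $i+j$ is odd; a $C_4$-face-magic projective labeling with value $2mn+3$ is bicentrally balanced if $x_{i,j}+x_{m+1-i,n+1-j}=S(i,j)$ for all $(i,j)$. Elementary projective labeling operations on a bicentrally balanced labeling $X=\{x_{i,j}\}$ (each producing $Z=\{z_{i,j}\}$) are: (a) for a permutation $\eta$ of $\{1,\ldots,m_0\}$ with $\eta(i)\equiv i\pmod 2$: $z_{i,j}=x_{\eta(i),j}$, $z_{m_0^{+},j}=x_{m_0^{+},j}$,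 $z_{m+1-i,j}=x_{m+1-\eta(i),j}$ ($1\leqslant i\leqslant m_0$, $1\leqslant j\leqslant n$); (b) for a permutation $\kappa$ of $\{1,\ldots,n_0\}$ with $\kappa(j)\equiv j\pmod 2$: $z_{i,j}=x_{i,\kappa(j)}$, $z_{i,n_0^{+}}=x_{i,n_0^{+}}$, $z_{i,n+1-j}=x_{i,n+1-\kappa(j)}$ ($1\leqslant i\leqslant m$, $1\leqslant j\leqslant n_0$); (c) for $\alpha:\{1,\ldots,m_0\}\to\{0,1\}$: swap the labels of column $i$ (vertices $(i,\cdot)$) with those of column $m+1-i$ exactly when $\alpha(i)=1$, other labels unchanged; (d) for $\delta:\{1,\ldots,n_0\}\to\{0,1\}$: swap the labels of row $j$ (vertices $(\cdot,j)$) with those of row $n+1-j$ exactly when $\delta(j)=1$, other labels unchanged. Each such operation sends bicentrally balanced $C_4$-face-magic projective labelings to bicentrally balanced $C_4$-face-magic projective labelings. Two bicentrally balanced $C_4$-face-magic projective labelings are projective labeling equivalent if one can be obtained from the other by a finite sequence of elementary projective labeling operations. *)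

theory Defs
  imports Complex_Main "HOL-Library.FuncSet" "HOL-Combinatorics.Permutations"
begin

definition grid :: "nat \<Rightarrow> nat \<Rightarrow> (nat \<times> nat) set" where
  "grid m n = {1..m} \<times> {1..n}"

text \<open>
  The 4-cycle faces of the naturally embedded projective grid graph, as vertex sets. The two
  remaining faces are digons and impose no condition. For \<open>m, n \<ge> 2\<close> the four listed
  vertices are pairwise distinct, so summing over the vertex set is summing over the 4-cycle.
\<close>

definition C4_faces :: "nat \<Rightarrow> nat \<Rightarrow> (nat \<times> nat) set set" where
  "C4_faces m n =
     {{(i, j), (i + 1, j), (i, j + 1), (i + 1, j + 1)} | i j. i \<in> {1..m - 1} \<and> j \<in> {1..n - 1}}
   \<union> {{(i, n), (i + 1, n), (m + 1 - i, 1), (m - i, 1)} | i. i \<in> {1..m - 1}}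
   \<union> {{(m, j), (m, j + 1), (1, n + 1 - j), (1, n - j)} | j. j \<in> {1..n - 1}}"

text \<open>
  A labeling is a function on the vertices only; membership in \<^term>\<open>extensional (grid m n)\<close>
  makes its values off the grid irrelevant, so that HOL equality is equality of labelings.
\<close>

definition C4_face_magic :: "nat \<Rightarrow> nat \<Rightarrow> (nat \<times> nat \<Rightarrow> nat) \<Rightarrow> nat \<Rightarrow> bool" where
  "C4_face_magic m n x c \<longleftrightarrow>
     x \<in> extensional (grid m n) \<and> bij_betw x (grid m n) {1..m * n} \<and>
     (\<forall>F\<in>C4_faces m n. (\<Sum>v\<in>F. x v) = c)"

definition balance_sum :: "nat \<Rightarrow> nat \<Rightarrow> nat \<Rightarrow> nat \<Rightarrow> real" where
  "balance_sum m n i j =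
     (if even (i + j) then 1 / 2 * real (m * n) + 3 / 2 else 3 / 2 * real (m * n) + 3 / 2)"

definition bicentrally_balanced :: "nat \<Rightarrow> nat \<Rightarrow> (nat \<times> nat \<Rightarrow> nat) \<Rightarrow> bool" where
  "bicentrally_balanced m n x \<longleftrightarrow>
     C4_face_magic m n x (2 * m * n + 3) \<and>
     (\<forall>i\<in>{1..m}. \<forall>j\<in>{1..n}.
        real (x (i, j)) + real (x (m + 1 - i, n + 1 - j)) = balance_sum m n i j)"

text \<open>
  The elementary operations, for \<open>m = 2 * m0 + 1\<close> and \<open>n = 2 * n0 + 1\<close>, so that
  \<open>m0 = m div 2\<close> and \<open>n0 = n div 2\<close>. Each relation prescribes the values of \<open>z\<close> on the grid.
\<close>

definition column_perm_op ::
  "nat \<Rightarrow> nat \<Rightarrow> (nat \<times> nat \<Rightarrow> nat) \<Rightarrow> (nat \<times> nat \<Rightarrow> nat) \<Rightarrow> bool" where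
  "column_perm_op m n x z \<longleftrightarrow>
     (\<exists>\<eta>. \<eta> permutes {1..m div 2} \<and> (\<forall>i\<in>{1..m div 2}. \<eta> i mod 2 = i mod 2) \<and>
       (\<forall>j\<in>{1..n}. z (m div 2 + 1, j) = x (m div 2 + 1, j) \<and>
         (\<forall>i\<in>{1..m div 2}. z (i, j) = x (\<eta> i, j) \<and>
                            z (m + 1 - i, j) = x (m + 1 - \<eta> i, j))))"

definition row_perm_op ::
  "nat \<Rightarrow> nat \<Rightarrow> (nat \<times> nat \<Rightarrow> nat) \<Rightarrow> (nat \<times> nat \<Rightarrow> nat) \<Rightarrow> bool" where
  "row_perm_op m n x z \<longleftrightarrow>
     (\<exists>\<kappa>. \<kappa> permutes {1..n div 2} \<and> (\<forall>j\<in>{1..n div 2}. \<kappa> j mod 2 = j mod 2) \<and>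
       (\<forall>i\<in>{1..m}. z (i, n div 2 + 1) = x (i, n div 2 + 1) \<and>
         (\<forall>j\<in>{1..n div 2}. z (i, j) = x (i, \<kappa> j) \<and>
                            z (i, n + 1 - j) = x (i, n + 1 - \<kappa> j))))"

definition column_swap_op ::
  "nat \<Rightarrow> nat \<Rightarrow> (nat \<times> nat \<Rightarrow> nat) \<Rightarrow> (nat \<times> nat \<Rightarrow> nat) \<Rightarrow> bool" where
  "column_swap_op m n x z \<longleftrightarrow>
     (\<exists>\<alpha> :: nat \<Rightarrow> nat. \<alpha> \<in> {1..m div 2} \<rightarrow> {0, 1} \<and>
       (\<forall>j\<in>{1..n}. z (m div 2 + 1, j) = x (m div 2 + 1, j) \<and>
         (\<forall>i\<in>{1..m div 2}.
            z (i, j) = (if \<alpha> i = 1 then x (m + 1 - i, j) else x (i, j)) \<and>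
            z (m + 1 - i, j) = (if \<alpha> i = 1 then x (i, j) else x (m + 1 - i, j)))))"

definition row_swap_op ::
  "nat \<Rightarrow> nat \<Rightarrow> (nat \<times> nat \<Rightarrow> nat) \<Rightarrow> (nat \<times> nat \<Rightarrow> nat) \<Rightarrow> bool" where
  "row_swap_op m n x z \<longleftrightarrow>
     (\<exists>\<delta> :: nat \<Rightarrow> nat. \<delta> \<in> {1..n div 2} \<rightarrow> {0, 1} \<and>
       (\<forall>i\<in>{1..m}. z (i, n div 2 + 1) = x (i, n div 2 + 1) \<and>
         (\<forall>j\<in>{1..n div 2}.
            z (i, j) = (if \<delta> j = 1 then x (i, n + 1 - j) else x (i, j)) \<and>
            z (i, n + 1 - j) = (if \<delta> j = 1 then x (i, j) else x (i, n + 1 - j)))))"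

definition elementary_op ::
  "nat \<Rightarrow> nat \<Rightarrow> (nat \<times> nat \<Rightarrow> nat) \<Rightarrow> (nat \<times> nat \<Rightarrow> nat) \<Rightarrow> bool" where
  "elementary_op m n x z \<longleftrightarrow>
     bicentrally_balanced m n x \<and> z \<in> extensional (grid m n) \<and>
     (column_perm_op m n x z \<or> row_perm_op m n x z \<or>
      column_swap_op m n x z \<or> row_swap_op m n x z)"

definition projective_labeling_equivalent ::
  "nat \<Rightarrow> nat \<Rightarrow> (nat \<times> nat \<Rightarrow> nat) \<Rightarrow> (nat \<times> nat \<Rightarrow> nat) \<Rightarrow> bool" where
  "projective_labeling_equivalent m n x z \<longleftrightarrow>
     bicentrally_balanced m n x \<and> bicentrally_balanced m n z \<and>
     ((elementary_op m n)\<^sup>*\<^sup>* x z \<or> (elementary_op m n)\<^sup>*\<^sup>* z x)"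

end

theory Submission imports Defs begin

text \<open>
  Every elementary operation relabels \<open>x\<close> as \<open>(i, j) \<mapsto> x (\<sigma> i, \<tau> j)\<close>, where \<open>\<sigma>\<close> and \<open>\<tau>\<close> are
  permutations that preserve parity and commute with the reversals \<open>i \<mapsto> m + 1 - i\<close> and
  \<open>j \<mapsto> n + 1 - j\<close>, and all such relabelings arise. They fix the two central lines, so \<open>\<sigma>\<close> is
  determined by what it does to the labels \<open>x (i, n0 + 1)\<close>, and \<open>\<tau>\<close> by \<open>x (m0 + 1, j)\<close>. On each
  parity class these labels are distinct and, by balance, their order is inverted by the
  reversal, so the permutation that sorts them commutes with the reversal; it is the unique
  one that sorts them.
\<close>

section \<open>Parity-preserving permutations commuting with the reversal, and relabelings by
  them\<close>

text \<open>\<open>permutes\<close> fixes every point outside \<open>{1..m}\<close>, so permutations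
  can be compared as functions and the uniqueness argument can end in an equation with
  \<open>id\<close>.\<close>

definition symmetric_perm :: "nat \<Rightarrow> (nat \<Rightarrow> nat) \<Rightarrow> bool" where
  "symmetric_perm m \<sigma> \<longleftrightarrow> \<sigma> permutes {1..m} \<and> (\<forall>i\<in>{1..m}. even (\<sigma> i) = even i) \<and>
     (\<forall>i\<in>{1..m}. \<sigma> (m + 1 - i) = m + 1 - \<sigma> i)"

definition relabel ::
  "nat \<Rightarrow> nat \<Rightarrow> (nat \<times> nat \<Rightarrow> nat) \<Rightarrow> (nat \<Rightarrow> nat) \<Rightarrow> (nat \<Rightarrow> nat) \<Rightarrow> nat \<times> nat \<Rightarrow> nat" where
  "relabel m n x \<sigma> \<tau> = restrict (\<lambda>(i, j). x (\<sigma> i, \<tau> j)) (grid m n)"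

lemma symmetric_permI:
  assumes "\<And>i. i \<in> {1..m} \<Longrightarrow> \<sigma> i \<in> {1..m}" "\<And>i. i \<notin> {1..m} \<Longrightarrow> \<sigma> i = i"
    and "inj_on \<sigma> {1..m}"
    and "\<And>i. i \<in> {1..m} \<Longrightarrow> even (\<sigma> i) = even i"
    and "\<And>i. i \<in> {1..m} \<Longrightarrow> \<sigma> (m + 1 - i) = m + 1 - \<sigma> i"
  shows "symmetric_perm m \<sigma>"
proof -
  have "\<sigma> ` {1..m} = {1..m}"
    by (rule endo_inj_surj) (use assms in auto)
  then have "\<sigma> permutes {1..m}"
    using assms by (intro bij_imp_permutes) (auto simp: bij_betw_def)
  then show ?thesis
    using assms by (auto simp: symmetric_perm_def)
qed

lemma symmetric_perm_in:
  assumes "symmetric_perm m \<sigma>" shows "\<sigma> i \<in> {1..m} \<longleftrightarrow> i \<in> {1..m}"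
  using assms unfolding symmetric_perm_def by (meson permutes_in_image)

lemma symmetric_perm_id: "symmetric_perm m id"
  by (auto simp: symmetric_perm_def permutes_id)

lemma symmetric_perm_comp:
  assumes "symmetric_perm m \<sigma>" "symmetric_perm m \<tau>"
  shows "symmetric_perm m (\<sigma> \<circ> \<tau>)"
  using assms symmetric_perm_in[OF assms(2)]
  by (simp add: symmetric_perm_def permutes_compose del: atLeastAtMost_iff)

lemma symmetric_perm_inv:
  assumes "symmetric_perm m \<sigma>" shows "symmetric_perm m (inv \<sigma>)"
proof -
  have p: "\<sigma> permutes {1..m}" using assms by (simp add: symmetric_perm_def)
  have pi: "inv \<sigma> permutes {1..m}" using p by (rule permutes_inv)
  have s: "\<sigma> (inv \<sigma> i) = i" for i using permutes_inverses(1)[OF p] .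
  have "even (inv \<sigma> i) = even i \<and> inv \<sigma> (m + 1 - i) = m + 1 - inv \<sigma> i" if "i \<in> {1..m}" for i
  proof -
    have i: "inv \<sigma> i \<in> {1..m}" using that permutes_in_image[OF pi] by blast
    then have "\<sigma> (m + 1 - inv \<sigma> i) = m + 1 - i"
      using assms s by (simp add: symmetric_perm_def)
    then have "inv \<sigma> (m + 1 - i) = m + 1 - inv \<sigma> i"
      using permutes_inverses(2)[OF p] by metis
    then show ?thesis using assms i s unfolding symmetric_perm_def by metis
  qed
  then show ?thesis using pi by (auto simp: symmetric_perm_def)
qed

text \<open>The centre is the only fixed point of the reversal, and a map that commutes with the
  reversal preserves its fixed points.\<close>

lemma symmetric_perm_center:
  assumes "symmetric_perm m \<sigma>" "m = 2 * k + 1" shows "\<sigma> (k + 1) = k + 1"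
proof -
  have "k + 1 \<in> {1..m}" using assms by auto
  then have "\<sigma> (m + 1 - (k + 1)) = m + 1 - \<sigma> (k + 1)" "\<sigma> (k + 1) \<in> {1..m}"
    using assms(1) permutes_in_image[of \<sigma> "{1..m}" "k + 1"] unfolding symmetric_perm_def by blast+
  then show ?thesis using assms(2) by auto
qed

text \<open>The permutations act from the right: an index is moved by the later permutation first
  and then looked up in the earlier relabeling.\<close>

lemma relabel_relabel:
  assumes "symmetric_perm m \<sigma>'" "symmetric_perm n \<tau>'"
  shows "relabel m n (relabel m n x \<sigma> \<tau>) \<sigma>' \<tau>' = relabel m n x (\<sigma> \<circ> \<sigma>') (\<tau> \<circ> \<tau>')"
  using symmetric_perm_in[OF assms(1)] symmetric_perm_in[OF assms(2)]
  by (auto simp: relabel_def grid_def fun_eq_iff restrict_def)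

lemma relabel_id: "x \<in> extensional (grid m n) \<Longrightarrow> relabel m n x id id = x"
  by (auto simp: relabel_def extensional_def restrict_def)

lemma relabel_inverse:
  assumes "symmetric_perm m \<sigma>" "symmetric_perm n \<tau>" "x \<in> extensional (grid m n)"
  shows "relabel m n (relabel m n x \<sigma> \<tau>) (inv \<sigma>) (inv \<tau>) = x"
proof -
  have "\<sigma> \<circ> inv \<sigma> = id" "\<tau> \<circ> inv \<tau> = id"
    using assms permutes_inv_o(1) unfolding symmetric_perm_def by blast+
  then show ?thesis
    using assms by (simp add: relabel_relabel symmetric_perm_inv relabel_id)
qed

section \<open>Face sums and balance under relabeling\<close>

text \<open>Constant sums of neighbours force the sequence to alternate between \<open>a 1\<close>
  and \<open>c - a 1\<close>, so a value depends only on the parity of its index.\<close>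

lemma alternating_sum_parity:
  fixes a :: "nat \<Rightarrow> nat"
  assumes step: "\<And>i. i \<in> {1..m - 1} \<Longrightarrow> a i + a (i + 1) = c"
    and "i \<in> {1..m}" "i' \<in> {1..m}" "even i \<noteq> even i'"
  shows "a i + a i' = c"
proof -
  have m: "m \<ge> 2" using assms(2-4) by (cases "m = 1") auto
  have "1 \<in> {1..m - 1}" using m by auto
  \<comment> \<open>This bound makes the natural-number difference \<open>c - a 1\<close> a true
    one.\<close>
  then have le: "a 1 \<le> c" using step[of 1] by linarith
  have val: "l \<le> m \<Longrightarrow> a l = (if odd l then a 1 else c - a 1)" if "1 \<le> l" for l
    using that
  proof (induction l rule: dec_induct)
    case (step l)
    then have "a l + a (l + 1) = c" using assms(1)[of l] by auto
    then show ?case using step le by (auto split: if_splits)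
  qed auto
  have "a i = (if odd i then a 1 else c - a 1)" "a i' = (if odd i' then a 1 else c - a 1)"
    by (rule val; use assms(2,3) in simp)+
  then show ?thesis using assms(4) le by (cases "even i") simp_all
qed

text \<open>The alternation lemma is applied twice, first in the index \<open>i\<close> to sums of
  two neighbouring labels, then in \<open>l\<close> to the sums over \<open>i\<close> and
  \<open>i'\<close>. This frees the face condition from adjacency, so that it survives permutations
  that preserve parity.\<close>

lemma magic_rectangle:
  fixes x :: "nat \<times> nat \<Rightarrow> nat"
  assumes "\<And>i j. i \<in> {1..m - 1} \<Longrightarrow> j \<in> {1..n - 1} \<Longrightarrow>
      x (i, j) + x (i + 1, j) + x (i, j + 1) + x (i + 1, j + 1) = c"
    and i: "i \<in> {1..m}" "i' \<in> {1..m}" "even i \<noteq> even i'"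
    and j: "j \<in> {1..n}" "j' \<in> {1..n}" "even j \<noteq> even j'"
  shows "x (i, j) + x (i', j) + x (i, j') + x (i', j') = c"
proof -
  have "(x (i, l) + x (i, l + 1)) + (x (i', l) + x (i', l + 1)) = c" if "l \<in> {1..n - 1}" for l
    by (rule alternating_sum_parity[of m "\<lambda>i. x (i, l) + x (i, l + 1)", OF _ i])
      (use assms(1)[OF _ that] in force)
  then have "(x (i, j) + x (i', j)) + (x (i, j') + x (i', j')) = c"
    by (intro alternating_sum_parity[of n "\<lambda>l. x (i, l) + x (i', l)", OF _ j]) force
  then show ?thesis by simp
qed

text \<open>The faces that cross the boundary of the grid consist of two pairs of opposite vertices,
  so their condition is implied by balance.\<close>

lemma bicentrally_balanced_iff:
  assumes "odd m" "odd n" "m \<ge> 3" "n \<ge> 3"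
  shows "bicentrally_balanced m n x \<longleftrightarrow>
    x \<in> extensional (grid m n) \<and> bij_betw x (grid m n) {1..m * n} \<and>
    (\<forall>i\<in>{1..m - 1}. \<forall>j\<in>{1..n - 1}.
      x (i, j) + x (i + 1, j) + x (i, j + 1) + x (i + 1, j + 1) = 2 * m * n + 3) \<and>
    (\<forall>i\<in>{1..m}. \<forall>j\<in>{1..n}.
      real (x (i, j)) + real (x (m + 1 - i, n + 1 - j)) = balance_sum m n i j)"
    (is "_ \<longleftrightarrow> ?e \<and> ?b \<and> ?sq \<and> ?bal")
proof -
  have inner: "(\<Sum>v\<in>{(i, j), (i + 1, j), (i, j + 1), (i + 1, j + 1)}. x v)
      = x (i, j) + x (i + 1, j) + x (i, j + 1) + x (i + 1, j + 1)" for i j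
    by simp
  have c2: "(\<Sum>v\<in>{(i, n), (i + 1, n), (m + 1 - i, 1), (m - i, 1)}. x v) = 2 * m * n + 3"
    if bal: ?bal and i: "i \<in> {1..m - 1}" for i
  proof -
    have i': "i \<in> {1..m}" "i + 1 \<in> {1..m}" "n \<in> {1..n}" using i assms by auto
    have "real (x (i, n)) + real (x (m + 1 - i, 1)) = balance_sum m n i n"
      using bal[rule_format, OF i'(1,3)] by simp
    moreover have "real (x (i + 1, n)) + real (x (m - i, 1)) = balance_sum m n (i + 1) n"
      using bal[rule_format, OF i'(2,3)] by simp
    \<comment> \<open>The index sums \<open>i + n\<close> and \<open>i + 1 + n\<close> have opposite
      parity, so both values of \<open>balance_sum\<close> occur exactly once.\<close>
    moreover have "balance_sum m n i n + balance_sum m n (i + 1) n = real (2 * m * n + 3)"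
      by (simp add: balance_sum_def)
    ultimately have "real (x (i, n) + x (i + 1, n) + x (m + 1 - i, 1) + x (m - i, 1))
        = real (2 * m * n + 3)"
      by simp
    then have "x (i, n) + x (i + 1, n) + x (m + 1 - i, 1) + x (m - i, 1) = 2 * m * n + 3"
      by (simp only: of_nat_eq_iff)
    \<comment> \<open>These inequalities separate the four vertices, so the sum over the set has
      four terms.\<close>
    moreover have "m + 1 - i \<noteq> m - i" "n \<noteq> 1" using i assms by auto
    ultimately show ?thesis by simp
  qed
  have c3: "(\<Sum>v\<in>{(m, j), (m, j + 1), (1, n + 1 - j), (1, n - j)}. x v) = 2 * m * n + 3"
    if bal: ?bal and j: "j \<in> {1..n - 1}" for j
  proof -
    have j': "j \<in> {1..n}" "j + 1 \<in> {1..n}" "m \<in> {1..m}" using j assms by auto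
    have "real (x (m, j)) + real (x (1, n + 1 - j)) = balance_sum m n m j"
      using bal[rule_format, OF j'(3,1)] by simp
    moreover have "real (x (m, j + 1)) + real (x (1, n - j)) = balance_sum m n m (j + 1)"
      using bal[rule_format, OF j'(3,2)] by simp
    moreover have "balance_sum m n m j + balance_sum m n m (j + 1) = real (2 * m * n + 3)"
      by (simp add: balance_sum_def)
    ultimately have "real (x (m, j) + x (m, j + 1) + x (1, n + 1 - j) + x (1, n - j))
        = real (2 * m * n + 3)"
      by simp
    then have "x (m, j) + x (m, j + 1) + x (1, n + 1 - j) + x (1, n - j) = 2 * m * n + 3"
      by (simp only: of_nat_eq_iff)
    moreover have "n + 1 - j \<noteq> n - j" "m \<noteq> 1" using j assms by auto
    ultimately show ?thesis by simp
  qed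
  have "(\<forall>F\<in>C4_faces m n. (\<Sum>v\<in>F. x v) = 2 * m * n + 3) \<longleftrightarrow> ?sq" if bal: ?bal
  proof
    assume *: "\<forall>F\<in>C4_faces m n. (\<Sum>v\<in>F. x v) = 2 * m * n + 3"
    show ?sq
    proof (intro ballI)
      fix i j assume "i \<in> {1..m - 1}" "j \<in> {1..n - 1}"
      then have "{(i, j), (i + 1, j), (i, j + 1), (i + 1, j + 1)} \<in> C4_faces m n"
        unfolding C4_faces_def by blast
      with * show "x (i, j) + x (i + 1, j) + x (i, j + 1) + x (i + 1, j + 1) = 2 * m * n + 3"
        using inner by metis
    qed
  next
    assume sq: ?sq
    show "\<forall>F\<in>C4_faces m n. (\<Sum>v\<in>F. x v) = 2 * m * n + 3"
    proof
      fix F assume "F \<in> C4_faces m n"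
      then consider i j where "i \<in> {1..m - 1}" "j \<in> {1..n - 1}"
          "F = {(i, j), (i + 1, j), (i, j + 1), (i + 1, j + 1)}"
        | i where "i \<in> {1..m - 1}" "F = {(i, n), (i + 1, n), (m + 1 - i, 1), (m - i, 1)}"
        | j where "j \<in> {1..n - 1}" "F = {(m, j), (m, j + 1), (1, n + 1 - j), (1, n - j)}"
        unfolding C4_faces_def by blast
      then show "(\<Sum>v\<in>F. x v) = 2 * m * n + 3"
      proof cases
        case 1
        then show ?thesis unfolding 1(3) inner using sq by blast
      next
        case 2
        then show ?thesis using c2[OF bal] by simp
      next
        case 3
        then show ?thesis using c3[OF bal] by simp
      qed
    qed
  qed
  then show ?thesis
    unfolding bicentrally_balanced_def C4_face_magic_def by blast
qed

text \<open>Balance survives because the permutations commute with the reversals and keep the parity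
  of \<open>i + j\<close>. A unit square is sent to a rectangle whose two row indices, and two
  column indices, differ in parity, and \<open>magic_rectangle\<close> gives its sum.\<close>

lemma bicentrally_balanced_relabel:
  assumes "odd m" "odd n" "m \<ge> 3" "n \<ge> 3" and bal: "bicentrally_balanced m n x"
    and s: "symmetric_perm m \<sigma>" and t: "symmetric_perm n \<tau>"
  shows "bicentrally_balanced m n (relabel m n x \<sigma> \<tau>)"
proof -
  note iff = bicentrally_balanced_iff[OF assms(1-4)]
  note X = bal[unfolded iff]
  have sp: "\<sigma> permutes {1..m}" and tp: "\<tau> permutes {1..n}"
    using s t by (auto simp: symmetric_perm_def)
  have sin: "\<sigma> i \<in> {1..m}" if "i \<in> {1..m}" for i using symmetric_perm_in[OF s] that by blast
  have tin: "\<tau> i \<in> {1..n}" if "i \<in> {1..n}" for i using symmetric_perm_in[OF t] that by blast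
  have val: "relabel m n x \<sigma> \<tau> (i, j) = x (\<sigma> i, \<tau> j)" if "i \<in> {1..m}" "j \<in> {1..n}" for i j
    using that by (simp add: relabel_def grid_def)
  show ?thesis unfolding iff
  proof (intro conjI ballI)
    show "relabel m n x \<sigma> \<tau> \<in> extensional (grid m n)"
      by (simp add: relabel_def)
    have "bij_betw (map_prod \<sigma> \<tau>) (grid m n) (grid m n)"
      unfolding grid_def using permutes_imp_bij[OF sp] permutes_imp_bij[OF tp]
      by (simp add: bij_betw_def map_prod_inj_on map_prod_surj_on)
    then have "bij_betw (x \<circ> map_prod \<sigma> \<tau>) (grid m n) {1..m * n}"
      using X bij_betw_trans by blast
    then show "bij_betw (relabel m n x \<sigma> \<tau>) (grid m n) {1..m * n}"
      by (rule bij_betw_cong[THEN iffD1, rotated]) (auto simp: relabel_def)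
  next
    fix i j assume i: "i \<in> {1..m - 1}" and j: "j \<in> {1..n - 1}"
    then have ij: "i \<in> {1..m}" "i + 1 \<in> {1..m}" "j \<in> {1..n}" "j + 1 \<in> {1..n}" by auto
    have "x (\<sigma> i, \<tau> j) + x (\<sigma> (i + 1), \<tau> j) + x (\<sigma> i, \<tau> (j + 1)) + x (\<sigma> (i + 1), \<tau> (j + 1))
        = 2 * m * n + 3"
    proof (rule magic_rectangle[of m n])
      show "even (\<sigma> i) \<noteq> even (\<sigma> (i + 1))" "even (\<tau> j) \<noteq> even (\<tau> (j + 1))"
        using ij s t unfolding symmetric_perm_def by auto
    qed (use X sin tin ij in blast)+
    then show "relabel m n x \<sigma> \<tau> (i, j) + relabel m n x \<sigma> \<tau> (i + 1, j) +
        relabel m n x \<sigma> \<tau> (i, j + 1) + relabel m n x \<sigma> \<tau> (i + 1, j + 1) = 2 * m * n + 3"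
      using val ij by simp
  next
    fix i j assume ij: "i \<in> {1..m}" "j \<in> {1..n}"
    then have ij': "m + 1 - i \<in> {1..m}" "n + 1 - j \<in> {1..n}" by auto
    have "even (\<sigma> i + \<tau> j) = even (i + j)"
      "\<sigma> (m + 1 - i) = m + 1 - \<sigma> i" "\<tau> (n + 1 - j) = n + 1 - \<tau> j"
      using s t ij by (auto simp: symmetric_perm_def)
    moreover have "real (x (\<sigma> i, \<tau> j)) + real (x (m + 1 - \<sigma> i, n + 1 - \<tau> j))
        = balance_sum m n (\<sigma> i) (\<tau> j)"
      using X sin[OF ij(1)] tin[OF ij(2)] by blast
    ultimately show "real (relabel m n x \<sigma> \<tau> (i, j)) +
        real (relabel m n x \<sigma> \<tau> (m + 1 - i, n + 1 - j)) = balance_sum m n i j"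
      using val[OF ij] val[OF ij'] by (simp add: balance_sum_def)
  qed
qed

section \<open>Elementary operations as relabelings\<close>

text \<open>An index of the upper half is presented as the reversal of an index \<open>l\<close> of
  the lower half, which is how the operations refer to it.\<close>

lemma odd_half_cases:
  fixes i k m :: nat
  assumes "i \<in> {1..m}" "m = 2 * k + 1"
  obtains "i \<in> {1..k}" | "i = k + 1" | l where "l \<in> {1..k}" "i = m + 1 - l" "m + 1 - i = l"
proof -
  consider "i \<le> k" | "i = k + 1" | "i > k + 1" by linarith
  then show ?thesis
  proof cases
    case 3
    have "m + 1 - i \<in> {1..k}" "i = m + 1 - (m + 1 - i)" using 3 assms by auto
    then show ?thesis using that(3) by blast
  qed (use that assms in auto)
qed

lemma column_perm_op_symmetric_perm:
  assumes "odd m" "column_perm_op m n x z"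
  obtains \<sigma> where "symmetric_perm m \<sigma>"
    "\<And>i j. i \<in> {1..m} \<Longrightarrow> j \<in> {1..n} \<Longrightarrow> z (i, j) = x (\<sigma> i, j)"
proof -
  define k where "k = m div 2"
  have m: "m = 2 * k + 1" using assms(1) by (simp add: k_def)
  obtain \<eta> where \<eta>: "\<eta> permutes {1..k}" "\<And>i. i \<in> {1..k} \<Longrightarrow> \<eta> i mod 2 = i mod 2"
    and z: "\<And>i j. j \<in> {1..n} \<Longrightarrow> z (k + 1, j) = x (k + 1, j)"
      "\<And>i j. j \<in> {1..n} \<Longrightarrow> i \<in> {1..k} \<Longrightarrow> z (i, j) = x (\<eta> i, j)"
      "\<And>i j. j \<in> {1..n} \<Longrightarrow> i \<in> {1..k} \<Longrightarrow> z (m + 1 - i, j) = x (m + 1 - \<eta> i, j)"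
    using assms(2) unfolding column_perm_op_def k_def[symmetric] by blast
  have in_k: "\<eta> i \<in> {1..k}" if "i \<in> {1..k}" for i using permutes_in_image[OF \<eta>(1)] that by blast
  have par: "even (\<eta> i) = even i" if "i \<in> {1..k}" for i
    using \<eta>(2)[OF that] by (simp add: even_iff_mod_2_eq_zero)
  have inj: "i = l" if "\<eta> i = \<eta> l" for i l
    using permutes_inj[OF \<eta>(1)] that by (rule injD)
  \<comment> \<open>\<open>\<eta>\<close> is reflected to the upper half and extended by the
    identity at the centre. Since \<open>m + 1\<close> is even, the reflection preserves
    parity.\<close>
  define \<sigma> where "\<sigma> i = (if i \<in> {1..k} then \<eta> i
    else if i \<in> {k+2..m} then m + 1 - \<eta> (m + 1 - i) else i)" for i
  have s1: "\<sigma> i = \<eta> i" "\<sigma> (m + 1 - i) = m + 1 - \<eta> i" if "i \<in> {1..k}" for i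
    using that m by (auto simp: \<sigma>_def)
  have s2: "\<sigma> (k + 1) = k + 1" by (simp add: \<sigma>_def)
  have "symmetric_perm m \<sigma>"
  proof (rule symmetric_permI)
    fix i assume i: "i \<in> {1..m}"
    have "\<sigma> i \<in> {1..m} \<and> even (\<sigma> i) = even i \<and> \<sigma> (m + 1 - i) = m + 1 - \<sigma> i"
      using i m
    proof (cases rule: odd_half_cases)
      case 1
      then show ?thesis using s1[OF 1] in_k[OF 1] par[OF 1] m by auto
    next
      case 2
      then show ?thesis using s2 m by simp
    next
      case (3 a)
      then show ?thesis using s1[OF 3(1)] in_k[OF 3(1)] par[OF 3(1)] m by auto
    qed
    then show "\<sigma> i \<in> {1..m}" "even (\<sigma> i) = even i" "\<sigma> (m + 1 - i) = m + 1 - \<sigma> i" by blast+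
  next
    show "inj_on \<sigma> {1..m}"
    proof (rule inj_onI)
      fix i l assume il: "i \<in> {1..m}" "l \<in> {1..m}" and eq: "\<sigma> i = \<sigma> l"
      \<comment> \<open>The lower half, the centre and the upper half are each kept by
        \<open>\<sigma>\<close>, so equal images come from the same part, where injectivity of
        \<open>\<eta>\<close> applies.\<close>
      have pos: "\<sigma> a \<le> k \<longleftrightarrow> a \<le> k" "\<sigma> a = k + 1 \<longleftrightarrow> a = k + 1" if "a \<in> {1..m}" for a
        using that m by (cases rule: odd_half_cases; use s1 s2 in_k m in force)+
      have il': "i \<le> k \<longleftrightarrow> l \<le> k" "i = k + 1 \<longleftrightarrow> l = k + 1"
        using pos[OF il(1)] pos[OF il(2)] eq by auto
      from il(1) m show "i = l"
      proof (cases rule: odd_half_cases)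
        case 1
        then have "l \<in> {1..k}" using il' il by auto
        then show ?thesis using 1 s1 eq inj by simp
      next
        case 2
        then show ?thesis using il' by simp
      next
        case (3 a)
        then have l: "m + 1 - l \<in> {1..k}" "m + 1 - (m + 1 - l) = l" using il' il m by auto
        then have "\<sigma> l = m + 1 - \<eta> (m + 1 - l)" using s1(2)[OF l(1)] by simp
        moreover have "\<sigma> i = m + 1 - \<eta> a" using 3 s1(2) by simp
        ultimately have "\<eta> a = \<eta> (m + 1 - l)"
          using eq in_k[OF 3(1)] in_k[OF l(1)] m by auto
        then show ?thesis using inj 3 l by metis
      qed
    qed
  qed (use m in \<open>auto simp: \<sigma>_def\<close>)
  moreover have "z (i, j) = x (\<sigma> i, j)" if "i \<in> {1..m}" "j \<in> {1..n}" for i j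
    using that(1) m by (cases rule: odd_half_cases) (use z s1 s2 that(2) in simp_all)
  ultimately show ?thesis using that by blast
qed

lemma column_swap_op_symmetric_perm:
  assumes "odd m" "column_swap_op m n x z"
  obtains \<sigma> where "symmetric_perm m \<sigma>"
    "\<And>i j. i \<in> {1..m} \<Longrightarrow> j \<in> {1..n} \<Longrightarrow> z (i, j) = x (\<sigma> i, j)"
proof -
  define k where "k = m div 2"
  have m: "m = 2 * k + 1" using assms(1) by (simp add: k_def)
  obtain \<alpha> :: "nat \<Rightarrow> nat" where z: "\<And>i j. j \<in> {1..n} \<Longrightarrow> z (k + 1, j) = x (k + 1, j)"
      "\<And>i j. j \<in> {1..n} \<Longrightarrow> i \<in> {1..k} \<Longrightarrow>
        z (i, j) = (if \<alpha> i = 1 then x (m + 1 - i, j) else x (i, j))"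
      "\<And>i j. j \<in> {1..n} \<Longrightarrow> i \<in> {1..k} \<Longrightarrow>
        z (m + 1 - i, j) = (if \<alpha> i = 1 then x (i, j) else x (m + 1 - i, j))"
    using assms(2) unfolding column_swap_op_def k_def[symmetric] by blast
  \<comment> \<open>\<open>min i (m + 1 - i)\<close> is the lower member of the pair of
    \<open>i\<close> and its reversal. Both members consult the same value of
    \<open>\<alpha>\<close>, so they are exchanged or kept together.\<close>
  define \<sigma> where "\<sigma> i = (if i \<in> {1..m} \<and> i \<noteq> k + 1 \<and> \<alpha> (min i (m + 1 - i)) = 1
    then m + 1 - i else i)" for i
  have "symmetric_perm m \<sigma>"
  proof (rule symmetric_permI)
    show "inj_on \<sigma> {1..m}"
    proof (rule inj_onI)
      fix i l assume il: "i \<in> {1..m}" "l \<in> {1..m}" and eq: "\<sigma> i = \<sigma> l"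
      then have "l = i \<or> l = m + 1 - i" by (auto simp: \<sigma>_def split: if_splits)
      then show "i = l" using il eq m by (auto simp: \<sigma>_def min.commute split: if_splits)
    qed
  qed (use m in \<open>auto simp: \<sigma>_def min.commute\<close>)
  moreover have "z (i, j) = x (\<sigma> i, j)" if "i \<in> {1..m}" "j \<in> {1..n}" for i j
    using that(1) m by (cases rule: odd_half_cases) (use z that(2) m in \<open>auto simp: \<sigma>_def\<close>)
  ultimately show ?thesis using that by blast
qed

text \<open>Transposing the grid turns rows into columns, so each argument about operations is
  carried out for columns only.\<close>

lemma row_perm_op_transpose:
  "row_perm_op m n x z \<longleftrightarrow> column_perm_op n m (x \<circ> prod.swap) (z \<circ> prod.swap)"
  by (simp add: row_perm_op_def column_perm_op_def)

lemma row_swap_op_transpose: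
  "row_swap_op m n x z \<longleftrightarrow> column_swap_op n m (x \<circ> prod.swap) (z \<circ> prod.swap)"
  by (simp add: row_swap_op_def column_swap_op_def)

lemma elementary_op_relabel:
  assumes "odd m" "odd n" "elementary_op m n x z"
  shows "\<exists>\<sigma> \<tau>. symmetric_perm m \<sigma> \<and> symmetric_perm n \<tau> \<and> z = relabel m n x \<sigma> \<tau>"
proof -
  have z: "z \<in> extensional (grid m n)" using assms(3) by (simp add: elementary_op_def)
  have col: ?thesis if "symmetric_perm m \<sigma>"
    "\<And>i j. i \<in> {1..m} \<Longrightarrow> j \<in> {1..n} \<Longrightarrow> z (i, j) = x (\<sigma> i, j)" for \<sigma>
  proof (intro exI conjI)
    show "z = relabel m n x \<sigma> id"
      using that z by (auto simp: relabel_def fun_eq_iff restrict_def grid_def extensional_def)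
  qed (use that symmetric_perm_id in auto)
  have row: ?thesis if "symmetric_perm n \<tau>"
    "\<And>j i. j \<in> {1..n} \<Longrightarrow> i \<in> {1..m} \<Longrightarrow> (z \<circ> prod.swap) (j, i) = (x \<circ> prod.swap) (\<tau> j, i)" for \<tau>
  proof (intro exI conjI)
    show "z = relabel m n x id \<tau>"
      using that z by (auto simp: relabel_def fun_eq_iff restrict_def grid_def extensional_def)
  qed (use that symmetric_perm_id in auto)
  consider "column_perm_op m n x z" | "column_swap_op m n x z"
    | "column_perm_op n m (x \<circ> prod.swap) (z \<circ> prod.swap)"
    | "column_swap_op n m (x \<circ> prod.swap) (z \<circ> prod.swap)"
    using assms(3) unfolding elementary_op_def row_perm_op_transpose row_swap_op_transpose
    by blast
  then show ?thesis
  proof cases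
    case 1
    show ?thesis by (rule column_perm_op_symmetric_perm[OF assms(1) 1]) (rule col)
  next
    case 2
    show ?thesis by (rule column_swap_op_symmetric_perm[OF assms(1) 2]) (rule col)
  next
    case 3
    show ?thesis by (rule column_perm_op_symmetric_perm[OF assms(2) 3]) (rule row)
  next
    case 4
    show ?thesis by (rule column_swap_op_symmetric_perm[OF assms(2) 4]) (rule row)
  qed
qed

lemma elementary_op_rtranclp_relabel:
  assumes "odd m" "odd n" "x \<in> extensional (grid m n)" "(elementary_op m n)\<^sup>*\<^sup>* x z"
  shows "\<exists>\<sigma> \<tau>. symmetric_perm m \<sigma> \<and> symmetric_perm n \<tau> \<and> z = relabel m n x \<sigma> \<tau>"
  using assms(4)
proof (induction rule: rtranclp_induct)
  case base
  then show ?case using symmetric_perm_id relabel_id[OF assms(3)] by metis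
next
  case (step y z)
  then obtain \<sigma> \<tau> where st: "symmetric_perm m \<sigma>" "symmetric_perm n \<tau>" "y = relabel m n x \<sigma> \<tau>"
    by blast
  obtain \<sigma>' \<tau>' where st': "symmetric_perm m \<sigma>'" "symmetric_perm n \<tau>'" "z = relabel m n y \<sigma>' \<tau>'"
    using elementary_op_relabel[OF assms(1,2) step.hyps(2)] by blast
  then show ?case
    using st relabel_relabel[OF st'(1,2)] symmetric_perm_comp by metis
qed

text \<open>Equivalence admits a sequence of operations in either direction; one that leads from
  \<open>z\<close> to \<open>x\<close> is undone by the inverse permutations.\<close>

lemma equivalent_relabel:
  assumes "odd m" "odd n" "projective_labeling_equivalent m n x z"
  shows "\<exists>\<sigma> \<tau>. symmetric_perm m \<sigma> \<and> symmetric_perm n \<tau> \<and> z = relabel m n x \<sigma> \<tau>"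
proof -
  have e: "x \<in> extensional (grid m n)" "z \<in> extensional (grid m n)"
    and r: "(elementary_op m n)\<^sup>*\<^sup>* x z \<or> (elementary_op m n)\<^sup>*\<^sup>* z x"
    using assms(3)
    by (auto simp: projective_labeling_equivalent_def bicentrally_balanced_def C4_face_magic_def)
  from r show ?thesis
  proof
    assume "(elementary_op m n)\<^sup>*\<^sup>* x z"
    then show ?thesis using elementary_op_rtranclp_relabel assms(1,2) e by blast
  next
    assume "(elementary_op m n)\<^sup>*\<^sup>* z x"
    then obtain \<sigma> \<tau> where "symmetric_perm m \<sigma>" "symmetric_perm n \<tau>" "x = relabel m n z \<sigma> \<tau>"
      using elementary_op_rtranclp_relabel assms(1,2) e by blast
    then show ?thesis using relabel_inverse e symmetric_perm_inv by metis
  qed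
qed

section \<open>Relabelings as sequences of elementary operations\<close>

text \<open>The permutation \<open>\<eta>\<close> folds \<open>\<sigma>\<close> onto the first half; a swap restores the side.\<close>

lemma symmetric_perm_column_ops:
  assumes "odd m" "symmetric_perm m \<sigma>"
  shows "\<exists>y \<in> extensional (grid m n).
    column_perm_op m n x y \<and> column_swap_op m n y (relabel m n x \<sigma> id)"
proof -
  define k where "k = m div 2"
  have m: "m = 2 * k + 1" using assms(1) by (simp add: k_def)
  have p: "\<sigma> permutes {1..m}" and sym: "\<And>i. i \<in> {1..m} \<Longrightarrow> \<sigma> (m + 1 - i) = m + 1 - \<sigma> i"
    and par: "\<And>i. i \<in> {1..m} \<Longrightarrow> even (\<sigma> i) = even i"
    using assms(2) by (auto simp: symmetric_perm_def)
  have cen: "\<sigma> (k + 1) = k + 1" using symmetric_perm_center[OF assms(2) m] .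
  have inj: "i = l" if "\<sigma> i = \<sigma> l" for i l
    using permutes_inj[OF p] that by (rule injD)
  \<comment> \<open>The centre is already the image of itself, so by injectivity no index of the
    lower half is sent there. Hence folding lands in \<open>{1..k}\<close>.\<close>
  have s: "\<sigma> i \<in> {1..m}" "\<sigma> i \<noteq> k + 1" if "i \<in> {1..k}" for i
    using symmetric_perm_in[OF assms(2), of i] inj[of i "k + 1"] that m cen by auto
  define \<eta> where "\<eta> i = (if i \<in> {1..k} then min (\<sigma> i) (m + 1 - \<sigma> i) else i)" for i
  have \<eta>_in: "\<eta> i \<in> {1..k}" if "i \<in> {1..k}" for i
    using s[OF that] that m by (auto simp: \<eta>_def)
  have "inj_on \<eta> {1..k}"
  proof (rule inj_onI)
    fix i l assume il: "i \<in> {1..k}" "l \<in> {1..k}" "\<eta> i = \<eta> l"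
    \<comment> \<open>Equal folded values determine \<open>\<sigma> i\<close> up to reversal. The
      reversed case would give \<open>i = m + 1 - l\<close>, which is impossible for two indices of
      the lower half.\<close>
    then have "\<sigma> i = \<sigma> l \<or> \<sigma> i = m + 1 - \<sigma> l"
      using s[of i] s[of l] by (auto simp: \<eta>_def min_def split: if_splits)
    then show "i = l"
    proof
      assume "\<sigma> i = m + 1 - \<sigma> l"
      then have "\<sigma> i = \<sigma> (m + 1 - l)" using sym[of l] il(2) m by auto
      then have "i = m + 1 - l" by (rule inj)
      then show ?thesis using il m by auto
    qed (rule inj)
  qed
  then have "\<eta> ` {1..k} = {1..k}"
    by (intro endo_inj_surj) (use \<eta>_in in auto)
  then have \<eta>: "\<eta> permutes {1..k}"
    using \<open>inj_on \<eta> {1..k}\<close> by (intro bij_imp_permutes) (auto simp: bij_betw_def \<eta>_def)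
  have \<eta>_par: "\<eta> i mod 2 = i mod 2" if "i \<in> {1..k}" for i
  proof -
    have "even (\<eta> i) = even i" using that par[of i] s[OF that] m by (auto simp: \<eta>_def min_def)
    then show ?thesis by (metis even_iff_mod_2_eq_zero odd_iff_mod_2_eq_one)
  qed
  \<comment> \<open>The labeling between the two operations: columns are permuted by
    \<open>\<eta>\<close> and its reflection, but not yet swapped.\<close>
  define y where "y = restrict (\<lambda>(i, j). x (if i \<le> k then \<eta> i else if i = k + 1 then i
    else m + 1 - \<eta> (m + 1 - i), j)) (grid m n)"
  have y: "y (k + 1, j) = x (k + 1, j)" if "j \<in> {1..n}" for j
    using that m by (simp add: y_def grid_def)
  have y': "y (i, j) = x (\<eta> i, j)" "y (m + 1 - i, j) = x (m + 1 - \<eta> i, j)"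
    if "j \<in> {1..n}" "i \<in> {1..k}" for i j
    using that m by (auto simp: y_def grid_def)
  have "column_perm_op m n x y"
    unfolding column_perm_op_def k_def[symmetric]
    by (rule exI[of _ \<eta>]) (use \<eta> \<eta>_par y y' in blast)
  moreover have "column_swap_op m n y (relabel m n x \<sigma> id)"
  proof -
    \<comment> \<open>The centre is not a value of \<open>\<sigma>\<close> on the lower half, so
      \<open>\<sigma> i > k\<close> means that column \<open>i\<close> comes from the upper half and
      folding changed its side.\<close>
    define \<alpha> :: "nat \<Rightarrow> nat" where "\<alpha> i = (if \<sigma> i > k then 1 else 0)" for i
    have v: "relabel m n x \<sigma> id (i, j) = x (\<sigma> i, j)" if "i \<in> {1..m}" "j \<in> {1..n}" for i j
      using that by (simp add: relabel_def grid_def)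
    show ?thesis
      unfolding column_swap_op_def k_def[symmetric]
    proof (intro exI[of _ \<alpha>] conjI ballI)
      show "\<alpha> \<in> {1..k} \<rightarrow> {0, 1}" by (auto simp: \<alpha>_def)
    next
      fix j assume j: "j \<in> {1..n}"
      show "relabel m n x \<sigma> id (k + 1, j) = y (k + 1, j)"
        using y[OF j] v[of "k + 1" j] j cen m by simp
      fix i assume i: "i \<in> {1..k}"
      then have im: "i \<in> {1..m}" "m + 1 - i \<in> {1..m}" using m by auto
      note v1 = v[OF im(1) j] v[OF im(2) j] sym[OF im(1)]
      have e: "\<eta> i = (if \<sigma> i > k then m + 1 - \<sigma> i else \<sigma> i)"
        using i s[OF i] m by (auto simp: \<eta>_def min_def)
      have "m + 1 - (m + 1 - \<sigma> i) = \<sigma> i" using s[OF i] by auto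
      then show "relabel m n x \<sigma> id (i, j) = (if \<alpha> i = 1 then y (m + 1 - i, j) else y (i, j))"
        "relabel m n x \<sigma> id (m + 1 - i, j) = (if \<alpha> i = 1 then y (i, j) else y (m + 1 - i, j))"
        using v1 y'[OF j i] e by (simp_all add: \<alpha>_def)
    qed
  qed
  moreover have "y \<in> extensional (grid m n)" by (simp add: y_def)
  ultimately show ?thesis by blast
qed

lemma symmetric_perm_row_ops:
  assumes "odd n" "symmetric_perm n \<tau>"
  shows "\<exists>y \<in> extensional (grid m n).
    row_perm_op m n x y \<and> row_swap_op m n y (relabel m n x id \<tau>)"
proof -
  obtain y where y: "y \<in> extensional (grid n m)" "column_perm_op n m (x \<circ> prod.swap) y"
    "column_swap_op n m y (relabel n m (x \<circ> prod.swap) \<tau> id)"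
    using symmetric_perm_column_ops[OF assms] by blast
  have "relabel n m (x \<circ> prod.swap) \<tau> id = relabel m n x id \<tau> \<circ> prod.swap"
    by (auto simp: relabel_def grid_def fun_eq_iff restrict_def)
  moreover have "y \<circ> prod.swap \<in> extensional (grid m n)"
    using y(1) by (auto simp: extensional_def grid_def)
  ultimately show ?thesis
    using y by (intro bexI[of _ "y \<circ> prod.swap"])
      (simp_all add: row_perm_op_transpose row_swap_op_transpose comp_assoc)
qed

text \<open>\<open>elementary_op\<close> demands a balanced source, so operations can be chained
  only if every intermediate labeling is balanced.\<close>

lemma elementary_op_bicentrally_balanced:
  assumes "odd m" "odd n" "m \<ge> 3" "n \<ge> 3" "elementary_op m n x z"
  shows "bicentrally_balanced m n z"
proof -
  obtain \<sigma> \<tau> where "symmetric_perm m \<sigma>" "symmetric_perm n \<tau>" "z = relabel m n x \<sigma> \<tau>"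
    using elementary_op_relabel[OF assms(1,2,5)] by blast
  then show ?thesis
    using bicentrally_balanced_relabel assms unfolding elementary_op_def by blast
qed

text \<open>Four operations suffice: a column permutation and a column swap realize
  \<open>\<sigma>\<close>, then a row permutation and a row swap realize
  \<open>\<tau>\<close>.\<close>

lemma relabel_equivalent:
  assumes "odd m" "odd n" "m \<ge> 3" "n \<ge> 3" "bicentrally_balanced m n x"
    and s: "symmetric_perm m \<sigma>" and t: "symmetric_perm n \<tau>"
  shows "projective_labeling_equivalent m n x (relabel m n x \<sigma> \<tau>)"
proof -
  note bal = elementary_op_bicentrally_balanced[OF assms(1-4)]
  define u where "u = relabel m n x \<sigma> id"
  have u: "u \<in> extensional (grid m n)" by (simp add: u_def relabel_def)
  have z: "relabel m n x \<sigma> \<tau> = relabel m n u id \<tau>"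
    unfolding u_def by (simp add: relabel_relabel[OF symmetric_perm_id t])
  have zx: "relabel m n x \<sigma> \<tau> \<in> extensional (grid m n)" by (simp add: relabel_def)
  obtain y where y: "y \<in> extensional (grid m n)" "column_perm_op m n x y"
    "column_swap_op m n y u"
    using symmetric_perm_column_ops[OF assms(1) s] unfolding u_def by blast
  obtain w where w: "w \<in> extensional (grid m n)" "row_perm_op m n u w"
    "row_swap_op m n w (relabel m n x \<sigma> \<tau>)"
    using symmetric_perm_row_ops[OF assms(2) t] unfolding z by blast
  have 1: "elementary_op m n x y" using assms(5) y by (simp add: elementary_op_def)
  have 2: "elementary_op m n y u" using bal[OF 1] y u by (simp add: elementary_op_def)
  have 3: "elementary_op m n u w" using bal[OF 2] w by (simp add: elementary_op_def)
  have 4: "elementary_op m n w (relabel m n x \<sigma> \<tau>)"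
    using bal[OF 3] w zx by (simp add: elementary_op_def)
  have "(elementary_op m n)\<^sup>*\<^sup>* x (relabel m n x \<sigma> \<tau>)"
    using 1 2 3 4 by (meson converse_rtranclp_into_rtranclp rtranclp.rtrancl_refl)
  then show ?thesis
    using bal[OF 4] assms(5) by (simp add: projective_labeling_equivalent_def)
qed

section \<open>Existence and uniqueness of the sorting permutation\<close>

text \<open>There are \<open>k\<close> even and \<open>k + 1\<close> odd indices. Adding the least
  index of the class, \<open>2\<close> or \<open>1\<close>, gives the same total, so that the two
  classes can be treated together.\<close>

lemma card_parity_class:
  assumes "m = 2 * k + 1"
  shows "card {l \<in> {1..m}. even l = even (i::nat)} + (if even i then 2 else 1) = k + 2"
proof (cases "even i")
  case True
  have "{l \<in> {1..m}. even l = even i} = (\<lambda>t. 2 * t) ` {1..k}"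
    using True assms by (auto elim!: evenE)
  then show ?thesis using True by (simp add: card_image inj_on_def)
next
  case False
  have "{l \<in> {1..m}. even l = even i} = (\<lambda>t. 2 * t + 1) ` {0..k}"
    using False assms by (auto elim!: oddE)
  then show ?thesis using False by (simp add: card_image inj_on_def)
qed

text \<open>The sorting permutation is the inverse of \<open>\<rho>\<close>, which moves \<open>i\<close> to the position given by the
  rank of \<open>g i\<close> within the parity class of \<open>i\<close>.\<close>

lemma exists_sorting_symmetric_perm:
  fixes g :: "nat \<Rightarrow> int"
  assumes m: "m = 2 * k + 1"
    and inj: "\<And>i l. i \<in> {1..m} \<Longrightarrow> l \<in> {1..m} \<Longrightarrow> even i = even l \<Longrightarrow> g i = g l \<Longrightarrow> i = l"
    and sym: "\<And>i l. i \<in> {1..m} \<Longrightarrow> l \<in> {1..m} \<Longrightarrow> even i = even l \<Longrightarrow>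
        g i + g (m + 1 - i) = g l + g (m + 1 - l)"
  shows "\<exists>\<sigma>. symmetric_perm m \<sigma> \<and> (\<forall>i\<in>{1..m - 2}. g (\<sigma> i) < g (\<sigma> (i + 2)))"
proof -
  define C where "C i = {l \<in> {1..m}. even l = even i}" for i :: nat
  \<comment> \<open>The least index of the parity class; \<open>b i + 2 * r i\<close> is then the
    index of rank \<open>r i\<close> in that class, counted from zero.\<close>
  define b where "b i = (if even i then 2 else 1 :: nat)" for i :: nat
  define r where "r i = card {l \<in> C i. g l < g i}" for i
  define \<rho> where "\<rho> i = (if i \<in> {1..m} then b i + 2 * r i else i)" for i
  have C_card: "card (C i) + b i = k + 2" for i
    using card_parity_class[OF m] unfolding C_def b_def .
  have fin: "finite (C i)" for i by (simp add: C_def)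
  have C_eq: "C i = C l" "b i = b l" if "even i = even l" for i l
    using that by (simp_all add: C_def b_def)
  have r_mono: "r i < r l" if "i \<in> {1..m}" "even i = even l" "g i < g l" for i l
    unfolding r_def C_eq[OF that(2)]
  proof (rule psubset_card_mono)
    have "i \<in> {a \<in> C l. g a < g l}" using that by (simp add: C_def)
    moreover have "i \<notin> {a \<in> C l. g a < g i}" by simp
    ultimately show "{a \<in> C l. g a < g i} \<subset> {a \<in> C l. g a < g l}"
      using that(3) by fastforce
  qed (use fin in simp)
  \<comment> \<open>As \<open>g l + g (m + 1 - l)\<close> is constant on the class, the reversal
    carries the indices with value above \<open>g i\<close> to those with value below
    \<open>g (m + 1 - i)\<close>. So the rank of \<open>m + 1 - i\<close> counts what lies above
    \<open>i\<close>.\<close>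
  have r_rev: "r i + r (m + 1 - i) + 1 = card (C i)" if i: "i \<in> {1..m}" for i
  proof -
    have par: "even (m + 1 - l) = even l" if "l \<in> {1..m}" for l using that m by auto
    have "bij_betw (\<lambda>l. m + 1 - l) {l \<in> C i. g i < g l} {l \<in> C i. g l < g (m + 1 - i)}"
    proof (rule bij_betw_byWitness[where f' = "\<lambda>l. m + 1 - l"])
      have *: "m + 1 - l \<in> C i \<and> g i + g (m + 1 - i) = g l + g (m + 1 - l)
          \<and> m + 1 - (m + 1 - l) = l" if "l \<in> C i" for l
        using that i par[of l] sym[of i l] by (auto simp: C_def)
      show "(\<lambda>l. m + 1 - l) ` {l \<in> C i. g i < g l} \<subseteq> {l \<in> C i. g l < g (m + 1 - i)}"
        using * by force
      show "(\<lambda>l. m + 1 - l) ` {l \<in> C i. g l < g (m + 1 - i)} \<subseteq> {l \<in> C i. g i < g l}"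
        using * by force
    qed (auto simp: C_def)
    then have 1: "card {l \<in> C i. g i < g l} = r (m + 1 - i)"
      unfolding r_def C_eq(1)[OF par[OF i]] by (rule bij_betw_same_card)
    have "C i = insert i ({l \<in> C i. g l < g i} \<union> {l \<in> C i. g i < g l})"
      using i inj[OF i] by (auto simp: C_def) (metis linorder_neqE)+
    also have "card \<dots> = Suc (card ({l \<in> C i. g l < g i} \<union> {l \<in> C i. g i < g l}))"
      using fin by (intro card_insert_disjoint) auto
    also have "\<dots> = Suc (r i + r (m + 1 - i))"
      using fin 1 by (subst card_Un_disjoint) (auto simp: r_def)
    finally show ?thesis by simp
  qed
  have b: "b i \<ge> 1" "b i \<le> 2" "even (b i) = even i" for i by (auto simp: b_def)
  have "symmetric_perm m \<rho>"
  proof (rule symmetric_permI)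
    fix i assume i: "i \<in> {1..m}"
    have i': "m + 1 - i \<in> {1..m}" "even (m + 1 - i) = even i" using i m by auto
    \<comment> \<open>Doubling \<open>b i + r i + r (m + 1 - i) = k + 1\<close> gives
      \<open>\<rho> i + \<rho> (m + 1 - i) = m + 1\<close>; with \<open>b i \<ge> 1\<close> it also
      yields \<open>\<rho> i \<le> m\<close>.\<close>
    have eq: "r i + r (m + 1 - i) + 1 + b i = k + 2" using r_rev[OF i] C_card[of i] by simp
    show "\<rho> i \<in> {1..m}" using i eq b[of i] m by (auto simp: \<rho>_def)
    show "even (\<rho> i) = even i" using i b by (simp add: \<rho>_def)
    show "\<rho> (m + 1 - i) = m + 1 - \<rho> i"
      using i i' eq C_eq(2)[OF i'(2)] m by (simp add: \<rho>_def)
  next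
    show "inj_on \<rho> {1..m}"
    proof (rule inj_onI)
      fix i l assume il: "i \<in> {1..m}" "l \<in> {1..m}" "\<rho> i = \<rho> l"
      then have eq: "b i + 2 * r i = b l + 2 * r l" by (simp add: \<rho>_def)
      \<comment> \<open>Ranks contribute an even amount, so equal images lie in the same parity
        class.\<close>
      then have par: "even i = even l" using b(3) by (metis even_add even_mult_iff even_numeral)
      then have "r i = r l" using eq C_eq(2)[OF par] by simp
      then have "g i = g l" using r_mono[of i l] r_mono[of l i] il par by force
      then show "i = l" using inj il par by blast
    qed
  qed (auto simp: \<rho>_def)
  then have s: "symmetric_perm m (inv \<rho>)" and p: "\<rho> permutes {1..m}"
    using symmetric_perm_inv by (auto simp: symmetric_perm_def)
  have "g (inv \<rho> i) < g (inv \<rho> (i + 2))" if i: "i \<in> {1..m - 2}" for i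
  proof (rule ccontr)
    assume n: "\<not> ?thesis"
    have im: "i \<in> {1..m}" "i + 2 \<in> {1..m}" using i by auto
    define a c where "a = inv \<rho> i" and "c = inv \<rho> (i + 2)"
    have ac: "a \<in> {1..m}" "c \<in> {1..m}" using symmetric_perm_in[OF s] im by (auto simp: a_def c_def)
    have par: "even a = even c" using s im by (simp add: symmetric_perm_def a_def c_def)
    have "\<rho> a = i" "\<rho> c = i + 2" using permutes_inverses(1)[OF p] by (auto simp: a_def c_def)
    \<comment> \<open>Ranks increase from position \<open>i\<close> to position
      \<open>i + 2\<close>, whereas \<open>g c < g a\<close> would make them decrease and
      \<open>g c = g a\<close> would force \<open>a = c\<close>.\<close>
    then have "r a < r c" using ac C_eq(2)[OF par] by (simp add: \<rho>_def)
    moreover have "g c \<le> g a" using n by (simp add: a_def c_def)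
    moreover have "a = c" if "g c = g a" using inj[of a c] ac par that by simp
    ultimately show False using r_mono[of c a] ac par by fastforce
  qed
  then show ?thesis using s by blast
qed

text \<open>Since \<open>g\<close> and \<open>g \<circ> \<rho>\<close> both increase along each
  parity class, so does \<open>\<rho>\<close>. Induction in steps of two then gives
  \<open>i \<le> \<rho> i\<close>, and a permutation of \<open>{1..m}\<close> with this property is
  the identity.\<close>

lemma sorting_perm_unique:
  fixes g :: "nat \<Rightarrow> int"
  assumes \<rho>: "symmetric_perm m \<rho>"
    and g: "\<And>i. i \<in> {1..m - 2} \<Longrightarrow> g i < g (i + 2)"
    and g\<rho>: "\<And>i. i \<in> {1..m - 2} \<Longrightarrow> g (\<rho> i) < g (\<rho> (i + 2))"
  shows "\<rho> = id"
proof (rule permutes_natset_ge)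
  show "\<rho> permutes {1..m}" using \<rho> by (simp add: symmetric_perm_def)
  have par: "even (\<rho> i) = even i" if "i \<in> {1..m}" for i
    using \<rho> that by (simp add: symmetric_perm_def)
  have mono: "1 \<le> l \<Longrightarrow> l + 2 * t \<le> m \<Longrightarrow> g l \<le> g (l + 2 * t)" for l t
  proof (induction t)
    case (Suc t)
    then show ?case using g[of "l + 2 * t"] by force
  qed simp
  have "i \<in> {1..m} \<Longrightarrow> i \<le> \<rho> i" for i
  proof (induction i rule: less_induct)
    case (less i)
    have pos: "\<rho> i \<in> {1..m}" using symmetric_perm_in[OF \<rho>] less.prems by blast
    show ?case
    proof (cases "i \<le> 2")
      case True
      then have "i = 1 \<or> i = 2" using less.prems by auto
      moreover have "\<rho> i \<noteq> 1 \<or> odd i" using par[OF less.prems] by auto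
      ultimately show ?thesis using pos by auto
    next
      case False
      define l where "l = i - 2"
      have l: "i = l + 2" "l \<in> {1..m - 2}" "l \<in> {1..m}"
        using False less.prems by (auto simp: l_def)
      have "l \<le> \<rho> l" using less.IH[of l] l by auto
      moreover have "\<rho> l < \<rho> i"
      proof (rule ccontr)
        assume n: "\<not> ?thesis"
        have "even (\<rho> l - \<rho> i)" using n par[OF l(3)] par[OF less.prems] l(1) by auto
        then obtain t where "\<rho> l - \<rho> i = 2 * t" by (rule evenE)
        then have t: "\<rho> l = \<rho> i + 2 * t" using n by simp
        have "\<rho> l \<in> {1..m}" using symmetric_perm_in[OF \<rho>] l(3) by blast
        then have "g (\<rho> i) \<le> g (\<rho> l)" using mono[of "\<rho> i" t] t pos by auto
        then show False using g\<rho>[OF l(2)] l(1) by simp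
      qed
      \<comment> \<open>Equal parity sharpens \<open>\<rho> l < \<rho> i\<close> to
        \<open>\<rho> l + 2 \<le> \<rho> i\<close>, which is the step of two that the induction
        needs.\<close>
      moreover have "even (\<rho> l) = even (\<rho> i)" using par[OF l(3)] par[OF less.prems] l(1) by simp
      ultimately have "\<rho> i \<noteq> \<rho> l + 1" "\<rho> l < \<rho> i" "l \<le> \<rho> l" by auto
      then show ?thesis using l(1) by linarith
    qed
  qed
  then show "\<forall>i\<in>{1..m}. i \<le> \<rho> i" by blast
qed

section \<open>Alternating order along a central line\<close>

text \<open>\<open>f\<close> stands for the labels on a central line and \<open>s\<close> for the
  fixed coordinate of that line.\<close>

definition alternating_sorted :: "nat \<Rightarrow> nat \<Rightarrow> (nat \<Rightarrow> nat) \<Rightarrow> bool" where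
  "alternating_sorted m s f \<longleftrightarrow>
     (\<forall>i\<in>{1..m - 2}. even (i + s) \<longrightarrow> f i < f (i + 2)) \<and>
     (\<forall>i\<in>{1..m - 2}. odd (i + s) \<longrightarrow> f i > f (i + 2))"

text \<open>Negating the labels on the decreasing parity class turns the alternating order into
  plain increase on both classes; hence the passage to \<open>int\<close>.\<close>

definition signed :: "nat \<Rightarrow> (nat \<Rightarrow> nat) \<Rightarrow> nat \<Rightarrow> int" where
  "signed s f i = (if even (i + s) then int (f i) else - int (f i))"

lemma alternating_sorted_signed:
  "alternating_sorted m s f \<longleftrightarrow> (\<forall>i\<in>{1..m - 2}. signed s f i < signed s f (i + 2))"
  by (auto simp: alternating_sorted_def signed_def)

lemma signed_comp:
  assumes "symmetric_perm m \<sigma>" "i \<in> {1..m}"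
  shows "signed s (f \<circ> \<sigma>) i = signed s f (\<sigma> i)"
  using assms by (simp add: signed_def symmetric_perm_def)

lemma alternating_sorted_comp:
  assumes "symmetric_perm m \<sigma>"
  shows "alternating_sorted m s (f \<circ> \<sigma>) \<longleftrightarrow>
    (\<forall>i\<in>{1..m - 2}. signed s f (\<sigma> i) < signed s f (\<sigma> (i + 2)))"
proof -
  have "signed s (f \<circ> \<sigma>) i = signed s f (\<sigma> i)"
    "signed s (f \<circ> \<sigma>) (i + 2) = signed s f (\<sigma> (i + 2))" if "i \<in> {1..m - 2}" for i
    by (rule signed_comp[OF assms]; use that in auto)+
  then show ?thesis unfolding alternating_sorted_signed by simp
qed

lemma alternating_sorted_cong:
  assumes "\<And>i. i \<in> {1..m} \<Longrightarrow> f i = h i"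
  shows "alternating_sorted m s f \<longleftrightarrow> alternating_sorted m s h"
proof -
  have "f i = h i" "f (i + 2) = h (i + 2)" if "i \<in> {1..m - 2}" for i
    by (rule assms; use that in auto)+
  then show ?thesis unfolding alternating_sorted_def by simp
qed

text \<open>\<open>B\<close> expresses that the sum of opposite labels depends only on parity. The
  reversal preserves parity and hence signs, so the signed labels have constant opposite sums on
  each class.\<close>

lemma exists_alternating_sorted:
  fixes f :: "nat \<Rightarrow> nat" and B :: "bool \<Rightarrow> real"
  assumes "m = 2 * k + 1" and inj: "inj_on f {1..m}"
    and sum: "\<And>i. i \<in> {1..m} \<Longrightarrow> real (f i) + real (f (m + 1 - i)) = B (even i)"
  shows "\<exists>\<sigma>. symmetric_perm m \<sigma> \<and> alternating_sorted m s (f \<circ> \<sigma>)"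
proof -
  have "\<exists>\<sigma>. symmetric_perm m \<sigma> \<and>
      (\<forall>i\<in>{1..m - 2}. signed s f (\<sigma> i) < signed s f (\<sigma> (i + 2)))"
  proof (rule exists_sorting_symmetric_perm[OF assms(1)])
    fix i l assume il: "i \<in> {1..m}" "l \<in> {1..m}" "even i = even l"
    show "i = l" if "signed s f i = signed s f l"
    proof (rule inj_onD[OF inj _ il(1,2)])
      show "f i = f l" using that il(3) by (simp add: signed_def split: if_splits)
    qed
    have "real (f i + f (m + 1 - i)) = real (f l + f (m + 1 - l))"
      using sum il by simp
    then have "f i + f (m + 1 - i) = f l + f (m + 1 - l)" by (simp only: of_nat_eq_iff)
    then have "int (f i) + int (f (m + 1 - i)) = int (f l) + int (f (m + 1 - l))"
      by (metis of_nat_add)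
    moreover have "even (m + 1 - i) = even i" "even (m + 1 - l) = even l"
      using il assms(1) by auto
    ultimately show "signed s f i + signed s f (m + 1 - i) = signed s f l + signed s f (m + 1 - l)"
      using il(3) by (simp add: signed_def)
  qed
  then show ?thesis using alternating_sorted_comp by blast
qed

lemma alternating_sorted_unique:
  assumes "symmetric_perm m \<rho>" "alternating_sorted m s f" "alternating_sorted m s (f \<circ> \<rho>)"
  shows "\<rho> = id"
  using assms(2)[unfolded alternating_sorted_signed]
    assms(3)[unfolded alternating_sorted_comp[OF assms(1)]]
  by (intro sorting_perm_unique[OF assms(1), of "signed s f"]) blast+

section \<open>The unique sorted representative of an equivalence class\<close>

theorem theorem29:
  fixes m n m0 n0 :: nat and X :: "nat \<times> nat \<Rightarrow> nat"
  assumes "m \<ge> 3" and "n \<ge> 3" and "odd m" and "odd n"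
    and "m = 2 * m0 + 1" and "n = 2 * n0 + 1"
    and "bicentrally_balanced m n X"
  shows "\<exists>!Z. bicentrally_balanced m n Z \<and> projective_labeling_equivalent m n X Z \<and>
    (\<forall>i\<in>{1..m - 2}. even (i + (n0 + 1)) \<longrightarrow> Z (i, n0 + 1) < Z (i + 2, n0 + 1)) \<and>
    (\<forall>i\<in>{1..m - 2}. odd (i + (n0 + 1)) \<longrightarrow> Z (i, n0 + 1) > Z (i + 2, n0 + 1)) \<and>
    (\<forall>j\<in>{1..n - 2}. even (m0 + 1 + j) \<longrightarrow> Z (m0 + 1, j) < Z (m0 + 1, j + 2)) \<and>
    (\<forall>j\<in>{1..n - 2}. odd (m0 + 1 + j) \<longrightarrow> Z (m0 + 1, j) > Z (m0 + 1, j + 2))"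
proof -
  define srt where "srt Z \<longleftrightarrow>
    alternating_sorted m (n0 + 1) (\<lambda>i. Z (i, n0 + 1)) \<and>
    alternating_sorted n (m0 + 1) (\<lambda>j. Z (m0 + 1, j))" for Z :: "nat \<times> nat \<Rightarrow> nat"
  have cin: "m0 + 1 \<in> {1..m}" "n0 + 1 \<in> {1..n}" using assms by auto
  \<comment> \<open>Both permutations fix the centre, so each central line of the relabeling sees
    only one of them and the two sorting problems decouple.\<close>
  have srt_relabel: "srt (relabel m n x \<sigma> \<tau>) \<longleftrightarrow>
      alternating_sorted m (n0 + 1) ((\<lambda>i. x (i, n0 + 1)) \<circ> \<sigma>) \<and>
      alternating_sorted n (m0 + 1) ((\<lambda>j. x (m0 + 1, j)) \<circ> \<tau>)"
    if "symmetric_perm m \<sigma>" "symmetric_perm n \<tau>" for x \<sigma> \<tau>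
    unfolding srt_def
    using cin symmetric_perm_center[OF that(1) assms(5)] symmetric_perm_center[OF that(2) assms(6)]
    by (intro arg_cong2[of _ _ _ _ "(\<and>)"] alternating_sorted_cong)
      (auto simp: relabel_def grid_def)
  have X_inj: "inj_on X (grid m n)"
    and X_bal: "\<And>i j. i \<in> {1..m} \<Longrightarrow> j \<in> {1..n} \<Longrightarrow>
      real (X (i, j)) + real (X (m + 1 - i, n + 1 - j)) = balance_sum m n i j"
    using assms(7) by (auto simp: bicentrally_balanced_def C4_face_magic_def bij_betw_def)
  \<comment> \<open>The reversal fixes \<open>n0 + 1\<close>, so balance pairs labels on the same
    central line. As \<open>balance_sum\<close> depends only on parity, \<open>0\<close> and
    \<open>1\<close> represent the even and odd indices in \<open>B\<close>.\<close>
  have "\<exists>\<sigma>. symmetric_perm m \<sigma> \<and> alternating_sorted m (n0 + 1) ((\<lambda>i. X (i, n0 + 1)) \<circ> \<sigma>)"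
  proof (rule exists_alternating_sorted[OF assms(5), where
        B = "\<lambda>e. balance_sum m n (if e then 0 else 1) (n0 + 1)"])
    show "inj_on (\<lambda>i. X (i, n0 + 1)) {1..m}"
    proof (rule inj_onI)
      fix i l assume "i \<in> {1..m}" "l \<in> {1..m}" "X (i, n0 + 1) = X (l, n0 + 1)"
      then show "i = l"
        using inj_onD[OF X_inj, of "(i, n0 + 1)" "(l, n0 + 1)"] cin by (simp add: grid_def)
    qed
    show "real (X (i, n0 + 1)) + real (X (m + 1 - i, n0 + 1))
        = balance_sum m n (if even i then 0 else 1) (n0 + 1)" if "i \<in> {1..m}" for i
      using X_bal[OF that cin(2)] assms(6) by (auto simp: balance_sum_def)
  qed
  then obtain \<sigma> where \<sigma>: "symmetric_perm m \<sigma>"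
    "alternating_sorted m (n0 + 1) ((\<lambda>i. X (i, n0 + 1)) \<circ> \<sigma>)" by blast
  have "\<exists>\<tau>. symmetric_perm n \<tau> \<and> alternating_sorted n (m0 + 1) ((\<lambda>j. X (m0 + 1, j)) \<circ> \<tau>)"
  proof (rule exists_alternating_sorted[OF assms(6), where
        B = "\<lambda>e. balance_sum m n (m0 + 1) (if e then 0 else 1)"])
    show "inj_on (\<lambda>j. X (m0 + 1, j)) {1..n}"
    proof (rule inj_onI)
      fix j l assume "j \<in> {1..n}" "l \<in> {1..n}" "X (m0 + 1, j) = X (m0 + 1, l)"
      then show "j = l"
        using inj_onD[OF X_inj, of "(m0 + 1, j)" "(m0 + 1, l)"] cin by (simp add: grid_def)
    qed
    show "real (X (m0 + 1, j)) + real (X (m0 + 1, n + 1 - j))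
        = balance_sum m n (m0 + 1) (if even j then 0 else 1)" if "j \<in> {1..n}" for j
      using X_bal[OF cin(1) that] assms(5) by (auto simp: balance_sum_def)
  qed
  then obtain \<tau> where \<tau>: "symmetric_perm n \<tau>"
    "alternating_sorted n (m0 + 1) ((\<lambda>j. X (m0 + 1, j)) \<circ> \<tau>)" by blast
  define Z where "Z = relabel m n X \<sigma> \<tau>"
  have Z: "bicentrally_balanced m n Z" "projective_labeling_equivalent m n X Z" "srt Z"
    unfolding Z_def srt_relabel[OF \<sigma>(1) \<tau>(1)]
    using bicentrally_balanced_relabel[OF assms(3,4,1,2,7) \<sigma>(1) \<tau>(1)]
      relabel_equivalent[OF assms(3,4,1,2,7) \<sigma>(1) \<tau>(1)] \<sigma>(2) \<tau>(2) by blast+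
  have "Y = Z" if Y: "projective_labeling_equivalent m n X Y" "srt Y" for Y
  proof -
    obtain \<sigma>' \<tau>' where st': "symmetric_perm m \<sigma>'" "symmetric_perm n \<tau>'" "Y = relabel m n X \<sigma>' \<tau>'"
      using equivalent_relabel[OF assms(3,4) Y(1)] by blast
    \<comment> \<open>These permutations carry \<open>Z\<close> to \<open>Y\<close>. Both labelings
      are sorted, so uniqueness of sorting makes them identities.\<close>
    define \<rho> \<pi> where "\<rho> = inv \<sigma> \<circ> \<sigma>'" and "\<pi> = inv \<tau> \<circ> \<tau>'"
    have X: "X = relabel m n Z (inv \<sigma>) (inv \<tau>)"
      unfolding Z_def using assms(7) \<sigma>(1) \<tau>(1)
      by (simp add: relabel_inverse bicentrally_balanced_def C4_face_magic_def)
    have YZ: "Y = relabel m n Z \<rho> \<pi>"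
      unfolding st'(3) \<rho>_def \<pi>_def by (subst X) (rule relabel_relabel[OF st'(1,2)])
    have r: "symmetric_perm m \<rho>" "symmetric_perm n \<pi>"
      unfolding \<rho>_def \<pi>_def using st' \<sigma>(1) \<tau>(1)
      by (auto intro: symmetric_perm_comp symmetric_perm_inv)
    have "\<rho> = id" "\<pi> = id"
      using Y(2) Z(3) unfolding YZ srt_relabel[OF r] srt_def[of Z]
      by (auto intro: alternating_sorted_unique[OF r(1)] alternating_sorted_unique[OF r(2)])
    then show ?thesis
      using YZ Z(1) by (simp add: relabel_id bicentrally_balanced_def C4_face_magic_def)
  qed
  then have "\<exists>!Z. bicentrally_balanced m n Z \<and> projective_labeling_equivalent m n X Z \<and> srt Z"
    using Z by blast
  \<comment> \<open>Commuting the sum matches \<open>m0 + 1 + j\<close> in the claim with the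
    index-first form in \<open>alternating_sorted\<close>.\<close>
  then show ?thesis
    unfolding srt_def alternating_sorted_def add.commute[of _ "m0 + 1"] conj_assoc .
qed

end
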